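(* Let $a,b,c,d\in\mathcal A_n$ be such that each of $a,b$ alternates strongly with each of $c,d$, and $(a,b)(c,d)=0$ in $\mathcal A_{n+1}$. Suppose that $(a,b)$ and $(c,d)$ satisfy the norm condition, with constant $\chi$: $$n(a)^2=n(b)^2\neq 0,\quad n(c)^2=n(d)^2\neq 0,\quad \chi=\gamma_n\frac{n(a)}{n(b)}=\gamma_n\frac{n(b)}{n(a)}=\gamma_n\frac{n(c)}{n(d)}=\gamma_n\frac{n(d)}{n(c)}=\pm1.$$ Then there exists the following $6$-cycle in the directed zero divisor graph $\Gamma_Z(\mathcal A_{n+1})$: $$(a,b)\to(c,d)\to(\overline{ac},-\chi\, da)\to(a,-b)\to(c,-d)\to(\overline{ac},\chi\, da)\to(a,b).$$
   Context: Real Cayley–Dickson algebras: $\mathcal A_0=\mathbb R$ with the trivial involution. Given parameters $\gamma_0,\gamma_1,\dots,\gamma_n\in\{\pm1\}$, for $0\le k\le n$ the algebra $\mathcal A_{k+1}=\mathcal A_k\times\mathcal A_k$ has componentwise addition and real scaling, product $(a,b)(c,d)=(ac+\gamma_k\bar d b,\ da+b\bar c)$ and involution $\overline{(a,b)}=(\bar a,-b)$; here $n\ge 0$ is an integer. The norm is $n(a)=a\bar a=\bar a a\in\mathbb R$. An element $x\in\mathcal A_n$ alternates strongly with $y\in\mathcal A_n$ if $(xx)y=x(xy)$ and $(yy)x=y(yx)$. The directed zero divisor graph $\Gamma_Z(\mathcal A)$ of a real algebra $\mathcal A$ has as vertices the lines $[x]=\mathbb R x$ through (left, right or two-sided) zero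 divisors $x\neq 0$ of $\mathcal A$, and distinct vertices $[x]$ and $[y]$ form a directed edge from $[x]$ to $[y]$ if and only if $xy=0$. When speaking of vertices, a nonzero element $x$ is identified with the line $[x]$ through it.
   Formalization: For χ=1 some of the six displayed lines may coincide, so the 6-cycle is claimed only if they are pairwise distinct (proved for χ=−1). In all cases the six lines are vertices, consecutive products vanish, and distinct consecutive vertices are joined by edges. *)

theory Defs
  imports Complex_Main "Graph_Theory.Arc_Walk"
begin

section \<open>Real Cayley-Dickson algebras\<close>

text \<open>
  The dimension of the \<open>n\<close>-th algebra depends on \<open>n\<close>, so all algebras live in one type of
  binary trees: the underlying set of the \<open>n\<close>-th algebra consists of the perfect trees of
  depth \<open>n\<close>, with \<open>CPair a b\<close> for the pair \<open>(a, b)\<close>. On trees of unequal shape the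
  operations return the junk value \<open>CReal 0\<close>.
\<close>

datatype cd = CReal real | CPair cd cd

fun cd_carrier :: "nat \<Rightarrow> cd set" where
  "cd_carrier 0 = range CReal"
| "cd_carrier (Suc n) = {CPair a b | a b. a \<in> cd_carrier n \<and> b \<in> cd_carrier n}"

fun cd_zero :: "nat \<Rightarrow> cd" where
  "cd_zero 0 = CReal 0"
| "cd_zero (Suc n) = CPair (cd_zero n) (cd_zero n)"

fun cd_one :: "nat \<Rightarrow> cd" where
  "cd_one 0 = CReal 1"
| "cd_one (Suc n) = CPair (cd_one n) (cd_zero n)"

fun cd_add :: "cd \<Rightarrow> cd \<Rightarrow> cd" where
  "cd_add (CReal r) (CReal s) = CReal (r + s)"
| "cd_add (CPair a b) (CPair c d) = CPair (cd_add a c) (cd_add b d)"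
| "cd_add _ _ = CReal 0"

fun cd_scale :: "real \<Rightarrow> cd \<Rightarrow> cd" where
  "cd_scale t (CReal r) = CReal (t * r)"
| "cd_scale t (CPair a b) = CPair (cd_scale t a) (cd_scale t b)"

definition cd_neg :: "cd \<Rightarrow> cd" where
  "cd_neg x = cd_scale (- 1) x"

fun cd_conj :: "cd \<Rightarrow> cd" where
  "cd_conj (CReal r) = CReal r"
| "cd_conj (CPair a b) = CPair (cd_conj a) (cd_neg b)"

text \<open>\<open>cd_mult g n\<close> is the product of the \<open>n\<close>-th algebra with parameters \<open>g 0, \<dots>, g (n - 1)\<close>.\<close>

fun cd_mult :: "(nat \<Rightarrow> real) \<Rightarrow> nat \<Rightarrow> cd \<Rightarrow> cd \<Rightarrow> cd" where
  "cd_mult g 0 (CReal r) (CReal s) = CReal (r * s)"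
| "cd_mult g (Suc k) (CPair a b) (CPair c d) =
     CPair (cd_add (cd_mult g k a c) (cd_scale (g k) (cd_mult g k (cd_conj d) b)))
           (cd_add (cd_mult g k d a) (cd_mult g k b (cd_conj c)))"
| "cd_mult g _ _ _ = CReal 0"

text \<open>The real number \<open>a \<cdot> cd_conj a\<close>, where a real \<open>r\<close> is identified with the multiple
  \<open>r \<cdot> 1\<close> of the unit. It exists and is unique by \<open>cd_norm_conj\<close> below.\<close>

definition cd_norm :: "(nat \<Rightarrow> real) \<Rightarrow> nat \<Rightarrow> cd \<Rightarrow> real" where
  "cd_norm g n a = (THE r. cd_mult g n a (cd_conj a) = cd_scale r (cd_one n))"

definition cd_alternates_strongly :: "(nat \<Rightarrow> real) \<Rightarrow> nat \<Rightarrow> cd \<Rightarrow> cd \<Rightarrow> bool" where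
  "cd_alternates_strongly g n x y \<longleftrightarrow>
     cd_mult g n (cd_mult g n x x) y = cd_mult g n x (cd_mult g n x y) \<and>
     cd_mult g n (cd_mult g n y y) x = cd_mult g n y (cd_mult g n y x)"


section \<open>The directed zero divisor graph\<close>

definition cd_zero_divisor :: "(nat \<Rightarrow> real) \<Rightarrow> nat \<Rightarrow> cd \<Rightarrow> bool" where
  "cd_zero_divisor g n x \<longleftrightarrow>
     x \<in> cd_carrier n \<and> x \<noteq> cd_zero n \<and>
     (\<exists>y \<in> cd_carrier n. y \<noteq> cd_zero n \<and>
        (cd_mult g n x y = cd_zero n \<or> cd_mult g n y x = cd_zero n))"

definition cd_line :: "cd \<Rightarrow> cd set" where
  "cd_line x = {cd_scale t x | t. True}"

definition zero_divisor_graph ::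
    "(nat \<Rightarrow> real) \<Rightarrow> nat \<Rightarrow> (cd set, cd set \<times> cd set) pre_digraph" where
  "zero_divisor_graph g n =
     \<lparr> verts = {cd_line x | x. cd_zero_divisor g n x},
       arcs = {(cd_line x, cd_line y) | x y.
                 cd_zero_divisor g n x \<and> cd_zero_divisor g n y \<and>
                 cd_line x \<noteq> cd_line y \<and> cd_mult g n x y = cd_zero n},
       tail = fst, head = snd \<rparr>"

text \<open>The pairs of cyclically consecutive entries of a list,
  \<open>[x, y, z] \<mapsto> [(x, y), (y, z), (z, x)]\<close>.\<close>

definition cyclic_pairs :: "'a list \<Rightarrow> ('a \<times> 'a) list" where
  "cyclic_pairs xs = zip xs (rotate1 xs)"


section \<open>Well-definedness of the norm\<close>

lemma cd_closed [simp]: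
  "cd_zero n \<in> cd_carrier n"
  "cd_one n \<in> cd_carrier n"
  "x \<in> cd_carrier n \<Longrightarrow> cd_scale t x \<in> cd_carrier n"
  "x \<in> cd_carrier n \<Longrightarrow> cd_neg x \<in> cd_carrier n"
  "x \<in> cd_carrier n \<Longrightarrow> cd_conj x \<in> cd_carrier n"
proof -
  show sc: "x \<in> cd_carrier n \<Longrightarrow> cd_scale t x \<in> cd_carrier n" for x t n
    by (induction n arbitrary: x) auto
  then show ng: "x \<in> cd_carrier n \<Longrightarrow> cd_neg x \<in> cd_carrier n" for x n
    by (simp add: cd_neg_def)
  show "x \<in> cd_carrier n \<Longrightarrow> cd_conj x \<in> cd_carrier n"
    using ng by (induction n arbitrary: x) auto
  show z: "cd_zero n \<in> cd_carrier n" for n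
    by (induction n) auto
  show "cd_one n \<in> cd_carrier n"
    using z by (induction n) auto
qed

lemma cd_add_closed [simp]:
  "x \<in> cd_carrier n \<Longrightarrow> y \<in> cd_carrier n \<Longrightarrow> cd_add x y \<in> cd_carrier n"
  by (induction n arbitrary: x y) auto

lemma cd_mult_closed [simp]:
  "x \<in> cd_carrier n \<Longrightarrow> y \<in> cd_carrier n \<Longrightarrow> cd_mult g n x y \<in> cd_carrier n"
proof (induction n arbitrary: x y)
  case (Suc n)
  then show ?case by fastforce
qed auto

lemma cd_scale_scale [simp]: "cd_scale s (cd_scale t x) = cd_scale (s * t) x"
  by (induction x) auto

lemma cd_scale_1 [simp]: "cd_scale 1 x = x"
  by (induction x) auto

lemma cd_neg_neg [simp]: "cd_neg (cd_neg x) = x"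
  by (simp add: cd_neg_def)

lemma cd_conj_scale: "cd_conj (cd_scale t x) = cd_scale t (cd_conj x)"
  by (induction x) (auto simp: cd_neg_def)

lemma cd_conj_conj [simp]: "cd_conj (cd_conj x) = x"
  by (induction x) auto

lemma cd_scale_add: "cd_scale t (cd_add x y) = cd_add (cd_scale t x) (cd_scale t y)"
  by (induction x y rule: cd_add.induct) (auto simp: algebra_simps)

lemma cd_add_scale: "cd_add (cd_scale s x) (cd_scale t x) = cd_scale (s + t) x"
  by (induction x) (auto simp: algebra_simps)

lemma cd_scale_0: "x \<in> cd_carrier n \<Longrightarrow> cd_scale 0 x = cd_zero n"
  by (induction n arbitrary: x) auto

lemma cd_scale_zero [simp]: "cd_scale t (cd_zero n) = cd_zero n"
  by (induction n) auto

lemma cd_add_zero [simp]: "cd_add (cd_zero n) (cd_zero n) = cd_zero n"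
  by (induction n) auto

lemma cd_mult_scale:
  "cd_mult g n (cd_scale t x) y = cd_scale t (cd_mult g n x y)"
  "cd_mult g n x (cd_scale t y) = cd_scale t (cd_mult g n x y)"
  by (induction g n x y rule: cd_mult.induct)
    (auto simp: cd_conj_scale cd_scale_add mult_ac)

lemma cd_add_neg: "x \<in> cd_carrier n \<Longrightarrow> cd_add (cd_neg x) x = cd_zero n"
  using cd_add_scale[of "- 1" x 1] by (simp add: cd_neg_def cd_scale_0)

lemma cd_add_neg': "x \<in> cd_carrier n \<Longrightarrow> cd_add x (cd_neg x) = cd_zero n"
  using cd_add_scale[of 1 x "- 1"] by (simp add: cd_neg_def cd_scale_0)

lemma cd_norm_ex:
  "a \<in> cd_carrier n \<Longrightarrow>
   \<exists>r. cd_mult g n a (cd_conj a) = cd_scale r (cd_one n) \<and>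
       cd_mult g n (cd_conj a) a = cd_scale r (cd_one n)"
proof (induction n arbitrary: a)
  case 0
  then show ?case by auto
next
  case (Suc n)
  from Suc.prems obtain x y
    where a: "a = CPair x y" and x: "x \<in> cd_carrier n" and y: "y \<in> cd_carrier n" by auto
  obtain r where r: "cd_mult g n x (cd_conj x) = cd_scale r (cd_one n)"
    "cd_mult g n (cd_conj x) x = cd_scale r (cd_one n)" using Suc.IH[OF x] by auto
  obtain s where s: "cd_mult g n y (cd_conj y) = cd_scale s (cd_one n)"
    "cd_mult g n (cd_conj y) y = cd_scale s (cd_one n)" using Suc.IH[OF y] by auto
  have n: "cd_conj (cd_neg y) = cd_neg (cd_conj y)" for y by (simp add: cd_neg_def cd_conj_scale)
  have m: "cd_mult g n (cd_neg u) v = cd_neg (cd_mult g n u v)"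
    "cd_mult g n u (cd_neg v) = cd_neg (cd_mult g n u v)" for u v
    by (simp_all add: cd_neg_def cd_mult_scale)
  show ?case
    using x y
    by (intro exI[of _ "r - g n * s"])
      (auto simp: a r s n m cd_add_neg cd_add_neg' cd_add_scale,
       auto simp: cd_neg_def cd_add_scale)
qed

lemma cd_scale_one_inj [simp]: "cd_scale r (cd_one n) = cd_scale s (cd_one n) \<longleftrightarrow> r = s"
  by (induction n) auto

lemma cd_norm_conj:
  assumes "a \<in> cd_carrier n"
  shows "cd_mult g n a (cd_conj a) = cd_scale (cd_norm g n a) (cd_one n)"
    and "cd_mult g n (cd_conj a) a = cd_scale (cd_norm g n a) (cd_one n)"
  using cd_norm_ex[OF assms, of g] by (auto simp: cd_norm_def)

end

theory Submission
  imports Defs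
begin

text \<open>
  If \<open>x\<close> alternates strongly with \<open>y\<close>, the conjugate of \<open>x\<close> cancels \<open>x\<close> up to the norm, on either
  side of \<open>y\<close>. The two components of \<open>(a, b)(c, d) = 0\<close> say \<open>a c = - \<gamma> d* b\<close> and
  \<open>d a = - b c*\<close>, where \<open>*\<close> is conjugation, so every product needed for the second and third arc
  cancels to a multiple of one of \<open>a*\<close>, \<open>b\<close>, \<open>c*\<close>, \<open>d\<close>, and the norm condition makes the multiples
  add up to zero. The remaining arcs follow from the automorphism \<open>(a, b) \<mapsto> (a, - b)\<close>.

  If two of the six lines coincide, then, up to this automorphism, one of the first two vertices \<open>p\<close>
  equals its own image or satisfies \<open>p p = 0\<close> or \<open>p p' = 0\<close> for its image \<open>p'\<close>. For \<open>\<chi> = - 1\<close>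
  each of these, together with the coincidence it comes from, contradicts the norm condition.
\<close>


section \<open>Arithmetic in Cayley-Dickson algebras\<close>

lemma cd_add_commute: "cd_add x y = cd_add y x"
  by (induction x y rule: cd_add.induct) auto

lemma cd_add_assoc:
  "x \<in> cd_carrier n \<Longrightarrow> y \<in> cd_carrier n \<Longrightarrow> z \<in> cd_carrier n \<Longrightarrow>
   cd_add (cd_add x y) z = cd_add x (cd_add y z)"
  by (induction n arbitrary: x y z) auto

lemma cd_add_left_commute:
  "x \<in> cd_carrier n \<Longrightarrow> y \<in> cd_carrier n \<Longrightarrow> z \<in> cd_carrier n \<Longrightarrow>
   cd_add x (cd_add y z) = cd_add y (cd_add x z)"
  by (metis cd_add_assoc cd_add_commute)

lemma cd_zero_add:
  "x \<in> cd_carrier n \<Longrightarrow> cd_add (cd_zero n) x = x"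
  "x \<in> cd_carrier n \<Longrightarrow> cd_add x (cd_zero n) = x"
  by (induction n arbitrary: x) auto

lemma cd_scale_eq_zero_iff:
  "x \<in> cd_carrier n \<Longrightarrow> cd_scale t x = cd_zero n \<longleftrightarrow> t = 0 \<or> x = cd_zero n"
  by (induction n arbitrary: x) auto

lemma cd_add_eq_zero_iff:
  "x \<in> cd_carrier n \<Longrightarrow> y \<in> cd_carrier n \<Longrightarrow> cd_add x y = cd_zero n \<longleftrightarrow> y = cd_neg x"
  by (induction n arbitrary: x y) (auto simp: cd_neg_def)

lemma cd_conj_zero: "cd_conj (cd_zero n) = cd_zero n"
  by (induction n) (auto simp: cd_neg_def)

lemma cd_conj_one: "cd_conj (cd_one n) = cd_one n"
  by (induction n) (auto simp: cd_neg_def)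

lemma cd_conj_add: "cd_conj (cd_add x y) = cd_add (cd_conj x) (cd_conj y)"
  by (induction x y rule: cd_add.induct) (auto simp: cd_neg_def cd_scale_add)

lemma cd_mult_zero:
  assumes "x \<in> cd_carrier n"
  shows "cd_mult g n (cd_zero n) x = cd_zero n" "cd_mult g n x (cd_zero n) = cd_zero n"
  using cd_mult_scale(1)[of g n 0 "cd_zero n" x] cd_mult_scale(2)[of g n x 0 "cd_zero n"] assms
  by (simp_all add: cd_scale_0[of _ n])

lemma cd_mult_one:
  "x \<in> cd_carrier n \<Longrightarrow> cd_mult g n (cd_one n) x = x"
  "x \<in> cd_carrier n \<Longrightarrow> cd_mult g n x (cd_one n) = x"
  by (induction n arbitrary: x)
    (auto simp: cd_mult_zero cd_conj_one cd_conj_zero cd_zero_add)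

text \<open>Both laws go through one induction: the product one level up moves a component of its
  right argument to the left, as in \<open>cd_conj d\<close> times \<open>b\<close>, so each law
  needs the other below.\<close>

lemma cd_mult_add:
  assumes "x \<in> cd_carrier n" "y \<in> cd_carrier n" "z \<in> cd_carrier n"
  shows "cd_mult g n (cd_add x y) z = cd_add (cd_mult g n x z) (cd_mult g n y z)"
    and "cd_mult g n z (cd_add x y) = cd_add (cd_mult g n z x) (cd_mult g n z y)"
  using assms
proof (induction n arbitrary: x y z)
  case 0
  {
    case 1 then show ?case by (auto simp: algebra_simps)
  next
    case 2 then show ?case by (auto simp: algebra_simps)
  }
next
  case (Suc n)
  note ac = cd_add_assoc[of _ n] cd_add_left_commute[of _ n] cd_add_commute
  {
    case 1 then show ?case
      by (auto simp: Suc.IH cd_conj_add cd_scale_add ac)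
  next
    case 2 then show ?case
      by (auto simp: Suc.IH cd_conj_add cd_scale_add ac)
  }
qed

lemma cd_conj_mult:
  "x \<in> cd_carrier n \<Longrightarrow> y \<in> cd_carrier n \<Longrightarrow>
   cd_conj (cd_mult g n x y) = cd_mult g n (cd_conj y) (cd_conj x)"
proof (induction n arbitrary: x y)
  case (Suc n)
  then show ?case
    by (auto simp: cd_conj_add cd_conj_scale cd_neg_def cd_mult_scale cd_scale_add cd_add_commute)
qed auto

text \<open>The scalar \<open>t\<close> is the trace of \<open>x\<close>. One level up, conjugation
  just negates the second component, so \<open>t\<close> comes from the first component
  alone.\<close>

lemma cd_conj_eq_trace:
  "x \<in> cd_carrier n \<Longrightarrow> \<exists>t. cd_conj x = cd_add (cd_scale t (cd_one n)) (cd_neg x)"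
proof (induction n arbitrary: x)
  case 0
  then obtain r where "x = CReal r" by auto
  then show ?case by (auto simp: cd_neg_def intro!: exI[of _ "2 * r"])
next
  case (Suc n)
  then show ?case by (fastforce simp: cd_zero_add cd_neg_def)
qed

lemma cd_norm_of_conj: "x \<in> cd_carrier n \<Longrightarrow> cd_norm g n (cd_conj x) = cd_norm g n x"
  by (metis cd_closed(5) cd_conj_conj cd_norm_conj cd_scale_one_inj)


lemma cd_norm_zero: "cd_norm g n (cd_zero n) = 0"
  using cd_norm_conj(1)[of "cd_zero n" n g] cd_scale_one_inj[of "cd_norm g n (cd_zero n)" n 0]
  by (simp add: cd_conj_zero cd_mult_zero cd_scale_0[of _ n])

lemma cd_scale_cancel:
  "x \<in> cd_carrier n \<Longrightarrow> cd_scale s x = cd_scale t x \<longleftrightarrow> s = t \<or> x = cd_zero n"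
  by (induction n arbitrary: x) auto

lemma cd_add_diff_cancel:
  "x \<in> cd_carrier n \<Longrightarrow> y \<in> cd_carrier n \<Longrightarrow> cd_add x (cd_add y (cd_neg x)) = y"
  by (induction n arbitrary: x y) (auto simp: cd_neg_def)

text \<open>Multiplication by \<open>cd_conj x\<close> is \<open>t\<close> minus multiplication by
  \<open>x\<close>, with the same trace \<open>t\<close> on both sides. The alternation laws for
  conjugates rest on this substitution.\<close>

lemma cd_mult_conj:
  assumes "x \<in> cd_carrier n"
  obtains t where
    "\<And>z. z \<in> cd_carrier n \<Longrightarrow> cd_mult g n (cd_conj x) z = cd_add (cd_scale t z) (cd_neg (cd_mult g n x z))"
    "\<And>z. z \<in> cd_carrier n \<Longrightarrow> cd_mult g n z (cd_conj x) = cd_add (cd_scale t z) (cd_neg (cd_mult g n z x))"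
proof -
  obtain t where "cd_conj x = cd_add (cd_scale t (cd_one n)) (cd_neg x)"
    using cd_conj_eq_trace[OF assms] by blast
  then show ?thesis
    using assms by (intro that[of t]) (simp_all add: cd_mult_add cd_mult_scale cd_mult_one cd_neg_def)
qed


section \<open>Strong alternation\<close>

text \<open>One half of strong alternation; each cancellation rule below uses a single
  direction.\<close>

definition cd_left_alternates :: "(nat \<Rightarrow> real) \<Rightarrow> nat \<Rightarrow> cd \<Rightarrow> cd \<Rightarrow> bool" where
  "cd_left_alternates g n x y \<longleftrightarrow>
     cd_mult g n (cd_mult g n x x) y = cd_mult g n x (cd_mult g n x y)"

lemma cd_alternates_strongly_iff:
  "cd_alternates_strongly g n x y \<longleftrightarrow> cd_left_alternates g n x y \<and> cd_left_alternates g n y x"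
  by (simp add: cd_alternates_strongly_def cd_left_alternates_def)

context
  fixes g :: "nat \<Rightarrow> real" and n :: nat and x y :: cd
  assumes x: "x \<in> cd_carrier n" and y: "y \<in> cd_carrier n"
    and alt: "cd_left_alternates g n x y"
begin

text \<open>The condition is linear in \<open>y\<close> and holds for the unit, and
  \<open>cd_conj y\<close> is a multiple of the unit minus \<open>y\<close>.\<close>

lemma cd_left_alternates_conj_right: "cd_left_alternates g n x (cd_conj y)"
proof -
  obtain t where "\<And>z. z \<in> cd_carrier n \<Longrightarrow>
      cd_mult g n z (cd_conj y) = cd_add (cd_scale t z) (cd_neg (cd_mult g n z y))"
    using cd_mult_conj[OF y] by blast
  then show ?thesis
    using x y alt by (simp add: cd_left_alternates_def cd_neg_def cd_mult_add cd_mult_scale)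
qed

text \<open>With the trace \<open>t\<close> of \<open>x\<close>, alternation turns
  \<open>t (x y) - x (x y)\<close> into \<open>(t x - x x) y\<close>, and \<open>t x - x x\<close>
  is \<open>cd_conj x\<close> times \<open>x\<close>, the norm.\<close>

lemma cd_mult_conj_cancel_left: "cd_mult g n (cd_conj x) (cd_mult g n x y) = cd_scale (cd_norm g n x) y"
proof -
  obtain t where t: "\<And>z. z \<in> cd_carrier n \<Longrightarrow>
      cd_mult g n (cd_conj x) z = cd_add (cd_scale t z) (cd_neg (cd_mult g n x z))"
    using cd_mult_conj[OF x] by blast
  have "cd_mult g n (cd_conj x) (cd_mult g n x y) = cd_mult g n (cd_mult g n (cd_conj x) x) y"
    using x y alt[unfolded cd_left_alternates_def]
    by (simp add: t cd_neg_def cd_mult_add cd_mult_scale)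
  then show ?thesis
    using x y by (simp add: cd_norm_conj cd_mult_scale cd_mult_one)
qed

text \<open>Expanding the inner \<open>cd_conj x\<close> and cancelling leaves \<open>t\<close>
  times \<open>cd_conj x\<close> minus the norm, acting on \<open>y\<close>. That is the square of
  \<open>cd_conj x\<close>, which has the same trace and norm as \<open>x\<close>.\<close>

lemma cd_left_alternates_conj_left: "cd_left_alternates g n (cd_conj x) y"
proof -
  obtain t where t: "\<And>z. z \<in> cd_carrier n \<Longrightarrow>
      cd_mult g n (cd_conj x) z = cd_add (cd_scale t z) (cd_neg (cd_mult g n x z))"
      "\<And>z. z \<in> cd_carrier n \<Longrightarrow>
      cd_mult g n z (cd_conj x) = cd_add (cd_scale t z) (cd_neg (cd_mult g n z x))"
    using cd_mult_conj[OF x] by blast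
  have "cd_mult g n (cd_conj x) (cd_mult g n (cd_conj x) y)
      = cd_add (cd_scale t (cd_mult g n (cd_conj x) y)) (cd_neg (cd_scale (cd_norm g n x) y))"
    using x y cd_mult_conj_cancel_left
    by (subst t(1)[of y]) (simp_all add: cd_neg_def cd_mult_add cd_mult_scale)
  also have "\<dots> = cd_mult g n (cd_add (cd_scale t (cd_conj x)) (cd_neg (cd_mult g n (cd_conj x) x))) y"
    using x y by (simp add: cd_norm_conj cd_neg_def cd_mult_add cd_mult_scale cd_mult_one)
  also have "cd_add (cd_scale t (cd_conj x)) (cd_neg (cd_mult g n (cd_conj x) x))
      = cd_mult g n (cd_conj x) (cd_conj x)"
    using x t(2)[of "cd_conj x"] by simp
  finally show ?thesis by (simp add: cd_left_alternates_def)
qed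

end

context
  fixes g :: "nat \<Rightarrow> real" and n :: nat and x y :: cd
  assumes x: "x \<in> cd_carrier n" and y: "y \<in> cd_carrier n"
    and alt: "cd_left_alternates g n x y"
begin

text \<open>The left cancellation for \<open>cd_conj x\<close> in place of \<open>x\<close>; the
  fresh context allows this instantiation.\<close>

lemma cd_mult_conj_cancel_left': "cd_mult g n x (cd_mult g n (cd_conj x) y) = cd_scale (cd_norm g n x) y"
  using cd_mult_conj_cancel_left[of "cd_conj x" n y g] cd_left_alternates_conj_left[OF x y alt] x y
  by (simp add: cd_norm_of_conj)

text \<open>Conjugation reverses products, so this is the conjugate of a left cancellation acting on
  \<open>cd_conj y\<close>.\<close>

lemma cd_mult_conj_cancel_right: "cd_mult g n (cd_mult g n y x) (cd_conj x) = cd_scale (cd_norm g n x) y"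
proof -
  have "cd_mult g n x (cd_mult g n (cd_conj x) (cd_conj y)) = cd_scale (cd_norm g n x) (cd_conj y)"
    using x y cd_left_alternates_conj_right[OF x y alt]
      cd_left_alternates_conj_left cd_mult_conj_cancel_left[of "cd_conj x" n "cd_conj y" g]
    by (simp add: cd_norm_of_conj)
  from arg_cong[OF this, of cd_conj] show ?thesis
    using x y by (simp add: cd_conj_mult cd_conj_scale)
qed

lemma cd_right_alternates: "cd_mult g n (cd_mult g n y x) x = cd_mult g n y (cd_mult g n x x)"
proof -
  have "cd_left_alternates g n (cd_conj x) (cd_conj y)"
    using x y alt by (simp add: cd_left_alternates_conj_left cd_left_alternates_conj_right)
  from arg_cong[OF this[unfolded cd_left_alternates_def], of cd_conj] show ?thesis
    using x y by (simp add: cd_conj_mult)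
qed

end

lemma cd_mult_conj_cancel_right':
  assumes "x \<in> cd_carrier n" "y \<in> cd_carrier n" "cd_left_alternates g n x y"
  shows "cd_mult g n (cd_mult g n y (cd_conj x)) x = cd_scale (cd_norm g n x) y"
  using cd_mult_conj_cancel_right[of "cd_conj x" n y g] cd_left_alternates_conj_left[OF assms] assms
  by (simp add: cd_norm_of_conj)


section \<open>Lines and the automorphism negating the second component\<close>

lemma cd_line_eqD:
  assumes "cd_line x = cd_line y"
  obtains t where "y = cd_scale t x"
proof -
  have "y \<in> cd_line y" unfolding cd_line_def using cd_scale_1[of y, symmetric] by blast
  with that show ?thesis unfolding assms[symmetric] by (auto simp: cd_line_def)
qed

text \<open>Turns a coincidence of lines into a new vanishing product, such as a square when the
  lines are adjacent.\<close>

lemma cd_line_mult_eq_zero: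
  assumes "cd_line x = cd_line y"
  shows "cd_mult g n z x = cd_zero n \<Longrightarrow> cd_mult g n z y = cd_zero n"
    and "cd_mult g n x z = cd_zero n \<Longrightarrow> cd_mult g n y z = cd_zero n"
  using cd_line_eqD[OF assms] by (metis cd_mult_scale cd_scale_zero)+

fun cd_flip :: "cd \<Rightarrow> cd" where
  "cd_flip (CReal r) = CReal r"
| "cd_flip (CPair a b) = CPair a (cd_neg b)"

lemma cd_flip_closed: "x \<in> cd_carrier n \<Longrightarrow> cd_flip x \<in> cd_carrier n"
  by (cases n) auto

lemma cd_flip_flip [simp]: "cd_flip (cd_flip x) = x"
  by (cases x) auto

lemma cd_flip_zero [simp]: "cd_flip (cd_zero n) = cd_zero n"
  by (cases n) (auto simp: cd_neg_def)

lemma cd_flip_eq_zero_iff [simp]: "cd_flip x = cd_zero n \<longleftrightarrow> x = cd_zero n"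
  by (metis cd_flip_flip cd_flip_zero)

lemma cd_flip_scale: "cd_flip (cd_scale t x) = cd_scale t (cd_flip x)"
  by (cases x) (auto simp: cd_neg_def)

text \<open>In the first component of a product, second components of the factors occur in pairs or
  not at all; in the second component each term has exactly one.\<close>

lemma cd_flip_mult: "cd_mult g n (cd_flip x) (cd_flip y) = cd_flip (cd_mult g n x y)"
  by (cases n; cases x; cases y)
    (auto simp: cd_neg_def cd_conj_scale cd_mult_scale cd_scale_add)

lemma cd_line_flip: "cd_line (cd_flip x) = cd_flip ` cd_line x"
  by (auto simp: cd_line_def cd_flip_scale[symmetric])

lemma cd_line_flip_eq_iff:
  "cd_line (cd_flip x) = cd_line (cd_flip y) \<longleftrightarrow> cd_line x = cd_line y"
proof -
  have "inj cd_flip" by (metis cd_flip_flip injI)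
  then show ?thesis by (simp add: cd_line_flip inj_image_eq_iff)
qed

lemma cd_line_flip_eq_swap: "cd_line (cd_flip x) = cd_line y \<longleftrightarrow> cd_line x = cd_line (cd_flip y)"
  using cd_line_flip_eq_iff[of x "cd_flip y"] by simp

text \<open>The scalar between the two would be \<open>1\<close> because of \<open>a\<close> and
  \<open>- 1\<close> because of \<open>b\<close>.\<close>

lemma cd_line_flip_neq:
  assumes "CPair a b \<in> cd_carrier (Suc n)" "a \<noteq> cd_zero n" "b \<noteq> cd_zero n"
  shows "cd_line (CPair a b) \<noteq> cd_line (cd_flip (CPair a b))"
proof
  assume "cd_line (CPair a b) = cd_line (cd_flip (CPair a b))"
  then obtain t where "cd_flip (CPair a b) = cd_scale t (CPair a b)"
    by (rule cd_line_eqD)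
  then show False
    using assms cd_scale_cancel[of a n 1 t] cd_scale_cancel[of b n "-1" t]
    by (auto simp: cd_neg_def)
qed

text \<open>The conclusion says that the norm of \<open>x = (a, b)\<close> is zero: \<open>x x = t x - r\<close> for the trace \<open>t\<close>
  and the norm \<open>r\<close> of \<open>x\<close>, and \<open>b \<noteq> 0\<close> makes \<open>x\<close> and \<open>1\<close> linearly independent.\<close>

lemma cd_square_eq_zeroD:
  assumes a: "a \<in> cd_carrier n" and b: "b \<in> cd_carrier n" "b \<noteq> cd_zero n"
    and "cd_mult g (Suc n) (CPair a b) (CPair a b) = cd_zero (Suc n)"
  shows "cd_norm g n a = g n * cd_norm g n b"
proof -
  have 1: "cd_add (cd_mult g n a a) (cd_scale (g n) (cd_mult g n (cd_conj b) b)) = cd_zero n"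
    and 2: "cd_add (cd_mult g n b a) (cd_mult g n b (cd_conj a)) = cd_zero n"
    using assms by auto
  obtain t where t: "\<And>z. z \<in> cd_carrier n \<Longrightarrow>
      cd_mult g n z (cd_conj a) = cd_add (cd_scale t z) (cd_neg (cd_mult g n z a))"
    using cd_mult_conj[OF a] by blast
  \<comment> \<open>The second component of the square is \<open>b\<close> times
    \<open>a + cd_conj a\<close>, that is \<open>t b\<close>.\<close>
  have "t = 0"
    using 2 a b by (simp add: t cd_add_diff_cancel[of _ n] cd_scale_eq_zero_iff)
  then have "cd_scale (cd_norm g n a) (cd_one n) = cd_neg (cd_mult g n a a)"
    using t[OF a] a by (simp add: cd_norm_conj cd_zero_add cd_scale_0[of _ n])
  also have "\<dots> = cd_scale (g n) (cd_mult g n (cd_conj b) b)"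
    using 1 a b by (simp add: cd_add_eq_zero_iff)
  finally show ?thesis
    using b by (simp add: cd_norm_conj)
qed

text \<open>The factor \<open>b\<close> stays in the second equation because it may be a zero
  divisor; the contradiction comes later, after moving to products with \<open>c\<close> or
  \<open>d\<close>.\<close>

lemma cd_mult_flip_eq_zeroD:
  assumes a: "a \<in> cd_carrier n" and b: "b \<in> cd_carrier n"
    and "cd_mult g (Suc n) (CPair a b) (cd_flip (CPair a b)) = cd_zero (Suc n)"
  shows "cd_mult g n a a = cd_scale (g n * cd_norm g n b) (cd_one n)"
    and "cd_mult g n b (cd_conj a) = cd_mult g n b a"
proof -
  have 1: "cd_add (cd_scale (- g n * cd_norm g n b) (cd_one n)) (cd_mult g n a a) = cd_zero n"
    and 2: "cd_add (cd_neg (cd_mult g n b a)) (cd_mult g n b (cd_conj a)) = cd_zero n"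
    using assms by (auto simp: cd_neg_def cd_conj_scale cd_mult_scale cd_norm_conj cd_add_commute)
  show "cd_mult g n a a = cd_scale (g n * cd_norm g n b) (cd_one n)"
    using 1 a by (simp add: cd_add_eq_zero_iff cd_neg_def)
  show "cd_mult g n b (cd_conj a) = cd_mult g n b a"
    using 2 a b by (simp add: cd_add_eq_zero_iff)
qed


section \<open>The hexagon\<close>

text \<open>The four quotients of the norm condition are condensed to \<open>norm_a\<close> and
  \<open>norm_c\<close>; the inverse ones follow since \<open>\<chi> * g n\<close> squares to
  1.\<close>

locale cd_hexagon =
  fixes g :: "nat \<Rightarrow> real" and n :: nat and a b c d :: cd and \<chi> :: real
  assumes closed: "a \<in> cd_carrier n" "b \<in> cd_carrier n" "c \<in> cd_carrier n" "d \<in> cd_carrier n"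
    and alternates: "\<And>x y. x \<in> {a, b} \<Longrightarrow> y \<in> {c, d} \<Longrightarrow> cd_alternates_strongly g n x y"
    and mult_zero: "cd_mult g (Suc n) (CPair a b) (CPair c d) = cd_zero (Suc n)"
    and norm_neq_0: "cd_norm g n a \<noteq> 0" "cd_norm g n b \<noteq> 0" "cd_norm g n c \<noteq> 0" "cd_norm g n d \<noteq> 0"
    and gamma: "g n = 1 \<or> g n = - 1" and chi: "\<chi> = 1 \<or> \<chi> = - 1"
    and norm_a: "cd_norm g n a = \<chi> * g n * cd_norm g n b"
    and norm_c: "cd_norm g n c = \<chi> * g n * cd_norm g n d"
begin

abbreviation mult (infixl "\<odot>" 70) where "x \<odot> y \<equiv> cd_mult g n x y"

text \<open>Half of the hexagon; the other three vertices are the images under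
  \<open>cd_flip\<close>.\<close>

abbreviation "P \<equiv> CPair a b"
abbreviation "Q \<equiv> CPair c d"
abbreviation "R \<equiv> CPair (cd_conj (a \<odot> c)) (cd_scale (- \<chi>) (d \<odot> a))"

lemma left_alternates:
  "x \<in> {a, b} \<Longrightarrow> y \<in> {c, d} \<Longrightarrow> cd_left_alternates g n x y"
  "x \<in> {a, b} \<Longrightarrow> y \<in> {c, d} \<Longrightarrow> cd_left_alternates g n y x"
  "x \<in> {a, b} \<Longrightarrow> y \<in> {c, d} \<Longrightarrow> cd_left_alternates g n x (cd_conj y)"
  "x \<in> {a, b} \<Longrightarrow> y \<in> {c, d} \<Longrightarrow> cd_left_alternates g n y (cd_conj x)"
  using alternates closed
  by (auto simp: cd_alternates_strongly_iff intro: cd_left_alternates_conj_right)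

lemma neq_zero: "a \<noteq> cd_zero n" "b \<noteq> cd_zero n" "c \<noteq> cd_zero n" "d \<noteq> cd_zero n"
  using norm_neq_0 by (metis cd_norm_zero)+

lemma mult_a_c: "a \<odot> c = cd_scale (- g n) (cd_conj d \<odot> b)"
proof -
  have "cd_add (cd_scale (g n) (cd_conj d \<odot> b)) (a \<odot> c) = cd_zero n"
    using mult_zero by (simp add: cd_add_commute)
  then show ?thesis using closed by (simp add: cd_add_eq_zero_iff cd_neg_def)
qed

lemma mult_d_a: "d \<odot> a = cd_scale (- 1) (b \<odot> cd_conj c)"
proof -
  have "cd_add (b \<odot> cd_conj c) (d \<odot> a) = cd_zero n"
    using mult_zero by (simp add: cd_add_commute)
  then show ?thesis using closed by (simp add: cd_add_eq_zero_iff cd_neg_def)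
qed

text \<open>The first form lets \<open>a\<close> and \<open>c\<close> cancel, the second lets
  \<open>b\<close> cancel.\<close>

lemma conj_mult_a_c:
  "cd_conj (a \<odot> c) = cd_conj c \<odot> cd_conj a"
  "cd_conj (a \<odot> c) = cd_scale (- g n) (cd_conj b \<odot> d)"
proof -
  show "cd_conj (a \<odot> c) = cd_conj c \<odot> cd_conj a"
    using closed by (simp add: cd_conj_mult)
  show "cd_conj (a \<odot> c) = cd_scale (- g n) (cd_conj b \<odot> d)"
    using closed by (simp add: mult_a_c cd_conj_mult cd_conj_scale)
qed

lemma R_closed: "R \<in> cd_carrier (Suc n)"
  using closed by auto

text \<open>Multiplying by \<open>c\<close> or \<open>cd_conj d\<close> recovers a nonzero multiple
  of \<open>cd_conj a\<close> or \<open>a\<close>.\<close>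

lemma R_neq_zero: "cd_conj (a \<odot> c) \<noteq> cd_zero n" "cd_scale (- \<chi>) (d \<odot> a) \<noteq> cd_zero n"
proof -
  have "c \<odot> cd_conj (a \<odot> c) = cd_scale (cd_norm g n c) (cd_conj a)"
    using closed left_alternates by (simp add: conj_mult_a_c(1) cd_mult_conj_cancel_left')
  moreover have "cd_conj a \<noteq> cd_zero n"
    using neq_zero(1) by (metis cd_conj_conj cd_conj_zero)
  ultimately show "cd_conj (a \<odot> c) \<noteq> cd_zero n"
    using closed norm_neq_0 cd_scale_eq_zero_iff[of "cd_conj a" n "cd_norm g n c"]
    by (auto simp: cd_mult_zero)
  have "cd_conj d \<odot> (d \<odot> a) = cd_scale (cd_norm g n d) a"
    using closed left_alternates by (simp add: cd_mult_conj_cancel_left)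
  then have "d \<odot> a \<noteq> cd_zero n"
    using closed norm_neq_0 neq_zero cd_scale_eq_zero_iff[of a n "cd_norm g n d"]
    by (auto simp: cd_mult_zero)
  then show "cd_scale (- \<chi>) (d \<odot> a) \<noteq> cd_zero n"
    using closed chi by (auto simp: cd_scale_eq_zero_iff)
qed

text \<open>Writing \<open>n(x)\<close> for the norm and \<open>\<gamma>\<close> for
  \<open>g n\<close>, the components are \<open>n(c) - \<chi> \<gamma> n(d)\<close> times
  \<open>cd_conj a\<close> and \<open>\<chi> n(c) - \<gamma> n(d)\<close> times
  \<open>b\<close>.\<close>

lemma mult_Q_R: "cd_mult g (Suc n) Q R = cd_zero (Suc n)"
proof -
  have "c \<odot> cd_conj (a \<odot> c) = cd_scale (cd_norm g n c) (cd_conj a)"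
    using closed left_alternates by (simp add: conj_mult_a_c(1) cd_mult_conj_cancel_left')
  moreover have "cd_conj (d \<odot> a) \<odot> d = cd_scale (cd_norm g n d) (cd_conj a)"
    using closed left_alternates by (simp add: cd_conj_mult cd_mult_conj_cancel_right')
  moreover have "(d \<odot> a) \<odot> c = cd_scale (- cd_norm g n c) b"
    using closed left_alternates by (simp add: mult_d_a cd_mult_scale cd_mult_conj_cancel_right')
  moreover have "d \<odot> (a \<odot> c) = cd_scale (- g n * cd_norm g n d) b"
    using closed left_alternates by (simp add: mult_a_c cd_mult_scale cd_mult_conj_cancel_left')
  ultimately show ?thesis
    using closed gamma chi
    by (auto simp: cd_mult_scale cd_conj_scale cd_add_scale norm_c cd_scale_0[of _ n])
qed

text \<open>Likewise, the components are \<open>n(a) - \<chi> \<gamma> n(b)\<close> times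
  \<open>cd_conj c\<close> and \<open>\<gamma> n(b) - \<chi> n(a)\<close> times
  \<open>d\<close>.\<close>

lemma mult_R_flip_P: "cd_mult g (Suc n) R (cd_flip P) = cd_zero (Suc n)"
proof -
  have "cd_conj (a \<odot> c) \<odot> a = cd_scale (cd_norm g n a) (cd_conj c)"
    using closed left_alternates by (simp add: conj_mult_a_c(1) cd_mult_conj_cancel_right')
  moreover have "cd_conj b \<odot> (d \<odot> a) = cd_scale (- cd_norm g n b) (cd_conj c)"
    using closed left_alternates by (simp add: mult_d_a cd_mult_scale cd_mult_conj_cancel_left)
  moreover have "b \<odot> cd_conj (a \<odot> c) = cd_scale (- g n * cd_norm g n b) d"
    using closed left_alternates by (simp add: conj_mult_a_c(2) cd_mult_scale cd_mult_conj_cancel_left')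
  moreover have "(d \<odot> a) \<odot> cd_conj a = cd_scale (cd_norm g n a) d"
    using closed left_alternates by (simp add: cd_mult_conj_cancel_right)
  ultimately show ?thesis
    using closed gamma chi
    by (auto simp: cd_neg_def cd_mult_scale cd_conj_scale cd_add_scale norm_a cd_scale_0[of _ n])
qed

lemma mult_flips:
  "cd_mult g (Suc n) (cd_flip P) (cd_flip Q) = cd_zero (Suc n)"
  "cd_mult g (Suc n) (cd_flip Q) (cd_flip R) = cd_zero (Suc n)"
  "cd_mult g (Suc n) (cd_flip R) P = cd_zero (Suc n)"
  using cd_flip_mult[of g "Suc n" P Q] cd_flip_mult[of g "Suc n" Q R]
    cd_flip_mult[of g "Suc n" R "cd_flip P"]
  by (simp_all only: mult_zero mult_Q_R mult_R_flip_P cd_flip_zero cd_flip_flip)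

section \<open>Distinctness of the six lines for \<open>\<chi> = - 1\<close>\<close>

context
  assumes chi_minus_1: "\<chi> = - 1"
begin

text \<open>The norm condition gives the opposite sign, and the norms are nonzero. Equivalently,
  \<open>P\<close> and \<open>Q\<close> have nonzero norm.\<close>

lemma norms_neq:
  "cd_norm g n a \<noteq> g n * cd_norm g n b" "cd_norm g n c \<noteq> g n * cd_norm g n d"
  using gamma norm_a norm_c norm_neq_0 by (auto simp: chi_minus_1)

lemma square_neq_zero:
  "cd_mult g (Suc n) P P \<noteq> cd_zero (Suc n)" "cd_mult g (Suc n) Q Q \<noteq> cd_zero (Suc n)"
  using cd_square_eq_zeroD closed neq_zero norms_neq by blast+

text \<open>The assumption makes \<open>a a\<close> equal to \<open>\<gamma> n(b)\<close>, while
  \<open>a\<close> times \<open>cd_conj a\<close> is \<open>n(a)\<close>; acting on \<open>d\<close>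
  from the right separates the two.\<close>

lemma conj_a_neq:
  assumes "cd_mult g (Suc n) P (cd_flip P) = cd_zero (Suc n)"
  shows "d \<odot> cd_conj a \<noteq> d \<odot> a" "(d \<odot> a) \<odot> cd_conj a \<noteq> (d \<odot> a) \<odot> a"
proof -
  have "(d \<odot> a) \<odot> a = cd_scale (g n * cd_norm g n b) d"
    using closed left_alternates cd_mult_flip_eq_zeroD(1)[OF closed(1,2) assms]
    by (simp add: cd_right_alternates cd_mult_scale cd_mult_one)
  moreover have "(d \<odot> cd_conj a) \<odot> a = cd_scale (cd_norm g n a) d"
    "(d \<odot> a) \<odot> cd_conj a = cd_scale (cd_norm g n a) d"
    using closed left_alternates by (simp_all add: cd_mult_conj_cancel_right cd_mult_conj_cancel_right')
  ultimately show "d \<odot> cd_conj a \<noteq> d \<odot> a" "(d \<odot> a) \<odot> cd_conj a \<noteq> (d \<odot> a) \<odot> a"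
    using closed neq_zero norms_neq by (metis cd_scale_cancel)+
qed

text \<open>The same argument for \<open>c\<close>, after rewriting \<open>d a\<close> as minus
  \<open>b\<close> times \<open>cd_conj c\<close>.\<close>

lemma conj_c_neq:
  assumes "cd_mult g (Suc n) Q (cd_flip Q) = cd_zero (Suc n)"
  shows "(d \<odot> a) \<odot> cd_conj c \<noteq> (d \<odot> a) \<odot> c"
proof -
  have "cd_conj c \<odot> cd_conj c = cd_conj (c \<odot> c)"
    using closed by (simp add: cd_conj_mult)
  also have "\<dots> = cd_scale (g n * cd_norm g n d) (cd_one n)"
    using cd_mult_flip_eq_zeroD(1)[OF closed(3,4) assms] by (simp add: cd_conj_scale cd_conj_one)
  finally have "b \<odot> (cd_conj c \<odot> cd_conj c) = cd_scale (g n * cd_norm g n d) b"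
    using closed by (simp add: cd_mult_scale cd_mult_one)
  then have "(b \<odot> cd_conj c) \<odot> cd_conj c = cd_scale (g n * cd_norm g n d) b"
    using closed left_alternates
    by (simp add: cd_right_alternates cd_left_alternates_conj_left)
  then have "(d \<odot> a) \<odot> cd_conj c = cd_scale (- (g n * cd_norm g n d)) b"
    by (simp add: mult_d_a cd_mult_scale)
  moreover have "(d \<odot> a) \<odot> c = cd_scale (- cd_norm g n c) b"
    using closed left_alternates by (simp add: mult_d_a cd_mult_scale cd_mult_conj_cancel_right')
  ultimately show ?thesis
    using closed neq_zero norms_neq by (simp add: cd_scale_cancel)
qed

text \<open>Up to \<open>cd_flip\<close> there are three pairs at each distance on the hexagon.
  Equal adjacent lines give a vanishing square, opposite lines are a vertex and its image, and equal
  lines at distance two make \<open>P\<close> or \<open>Q\<close> annihilate its own image.\<close>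

lemma lines_neq:
  "cd_line P \<noteq> cd_line Q" "cd_line P \<noteq> cd_line R" "cd_line P \<noteq> cd_line (cd_flip P)"
  "cd_line P \<noteq> cd_line (cd_flip Q)" "cd_line P \<noteq> cd_line (cd_flip R)"
  "cd_line Q \<noteq> cd_line R" "cd_line Q \<noteq> cd_line (cd_flip Q)" "cd_line Q \<noteq> cd_line (cd_flip R)"
  "cd_line R \<noteq> cd_line (cd_flip R)"
proof -
  show "cd_line P \<noteq> cd_line (cd_flip P)"
    using closed neq_zero by (intro cd_line_flip_neq[of _ _ n]) auto
  show "cd_line Q \<noteq> cd_line (cd_flip Q)"
    using closed neq_zero by (intro cd_line_flip_neq[of _ _ n]) auto
  show "cd_line R \<noteq> cd_line (cd_flip R)"
    using R_closed R_neq_zero by (rule cd_line_flip_neq)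
  show "cd_line P \<noteq> cd_line Q"
    using cd_line_mult_eq_zero(1)[of Q P g "Suc n" P] mult_zero square_neq_zero(1) by metis
  show "cd_line P \<noteq> cd_line (cd_flip R)"
    using cd_line_mult_eq_zero(2)[of "cd_flip R" P g "Suc n" P] mult_flips(3) square_neq_zero(1)
    by metis
  show "cd_line Q \<noteq> cd_line R"
    using cd_line_mult_eq_zero(1)[of R Q g "Suc n" Q] mult_Q_R square_neq_zero(2) by metis
  show "cd_line P \<noteq> cd_line R"
  proof
    assume eq: "cd_line P = cd_line R"
    have P: "cd_mult g (Suc n) P (cd_flip P) = cd_zero (Suc n)"
      using cd_line_mult_eq_zero(2)[OF eq[symmetric] mult_R_flip_P] .
    obtain t where "R = cd_scale t P" using cd_line_eqD[OF eq] .
    \<comment> \<open>Comparing second components transfers the commutation of \<open>a\<close> and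
      \<open>cd_conj a\<close> behind \<open>b\<close> to \<open>d a\<close>. The other two cases at
      distance two end in the same way.\<close>
    then have "d \<odot> a = cd_scale t b" by (simp add: chi_minus_1)
    with conj_a_neq(2)[OF P] show False
      using cd_mult_flip_eq_zeroD(2)[OF closed(1,2) P] by (simp add: cd_mult_scale)
  qed
  show "cd_line P \<noteq> cd_line (cd_flip Q)"
  proof
    assume eq: "cd_line P = cd_line (cd_flip Q)"
    then have "cd_line Q = cd_line (cd_flip P)" by (metis cd_line_flip_eq_swap)
    then have P: "cd_mult g (Suc n) P (cd_flip P) = cd_zero (Suc n)"
      using mult_zero by (rule cd_line_mult_eq_zero)
    obtain t where "cd_flip Q = cd_scale t P" using cd_line_eqD[OF eq] .
    then have "cd_neg (cd_neg d) = cd_neg (cd_scale t b)" by simp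
    then have "d = cd_scale (- t) b" unfolding cd_neg_neg by (simp add: cd_neg_def)
    with conj_a_neq(1)[OF P] show False
      using cd_mult_flip_eq_zeroD(2)[OF closed(1,2) P] by (simp add: cd_mult_scale)
  qed
  show "cd_line Q \<noteq> cd_line (cd_flip R)"
  proof
    assume eq: "cd_line Q = cd_line (cd_flip R)"
    then have "cd_line R = cd_line (cd_flip Q)" by (metis cd_line_flip_eq_swap)
    then have Q: "cd_mult g (Suc n) Q (cd_flip Q) = cd_zero (Suc n)"
      using mult_Q_R by (rule cd_line_mult_eq_zero)
    obtain t where "cd_flip R = cd_scale t Q" using cd_line_eqD[OF eq] .
    then have "cd_scale (- 1) (d \<odot> a) = cd_scale t d" by (simp add: chi_minus_1 cd_neg_def)
    from arg_cong[OF this, of "cd_scale (- 1)"]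
    have "d \<odot> a = cd_scale (- t) d" by simp
    with conj_c_neq[OF Q] show False
      using cd_mult_flip_eq_zeroD(2)[OF closed(3,4) Q] by (simp add: cd_mult_scale)
  qed
qed

text \<open>Of the 15 pairs, \<open>lines_neq\<close> covers nine and \<open>cd_flip\<close>
  supplies six; its equations are withheld from the simplifier to keep the images
  recognisable.\<close>

lemma distinct_lines:
  "distinct (map cd_line [P, Q, R, cd_flip P, cd_flip Q, cd_flip R])"
proof -
  have "cd_line Q \<noteq> cd_line (cd_flip P)" "cd_line R \<noteq> cd_line (cd_flip P)"
    "cd_line R \<noteq> cd_line (cd_flip Q)"
    using lines_neq cd_line_flip_eq_swap by metis+
  then show ?thesis
    using lines_neq by (auto simp: cd_line_flip_eq_iff simp del: cd_flip.simps)
qed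

end

lemma cyclic_products:
  "\<forall>(x, y) \<in> set (cyclic_pairs [P, Q, R, cd_flip P, cd_flip Q, cd_flip R]).
     cd_mult g (Suc n) x y = cd_zero (Suc n)"
  using mult_zero mult_Q_R mult_R_flip_P mult_flips
  by (simp add: cyclic_pairs_def del: cd_flip.simps cd_mult.simps cd_zero.simps)

lemma nonzero_vertices:
  "set [P, Q, R, cd_flip P, cd_flip Q, cd_flip R] \<subseteq> cd_carrier (Suc n) - {cd_zero (Suc n)}"
proof -
  have "{P, Q, R} \<subseteq> cd_carrier (Suc n) - {cd_zero (Suc n)}"
    using closed neq_zero R_neq_zero by auto
  then show ?thesis
    using cd_flip_closed[of _ "Suc n"]
    by (simp del: cd_flip.simps cd_carrier.simps cd_zero.simps)
qed

end

section \<open>From cyclic lists of vanishing products to cycles in the graph\<close>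

lemma cyclic_pairs_Cons: "cyclic_pairs (x # xs) = zip (x # xs) (xs @ [x])"
  by (simp add: cyclic_pairs_def)

lemma cyclic_pairs_map: "cyclic_pairs (map f xs) = map (map_prod f f) (cyclic_pairs xs)"
  by (simp add: cyclic_pairs_def rotate1_map zip_map_map map_prod_def)

lemma set_cyclic_pairs_subset: "set (cyclic_pairs xs) \<subseteq> set xs \<times> set xs"
  unfolding cyclic_pairs_def by (auto dest: set_zip_leftD set_zip_rightD)

lemma in_cyclic_pairs: "x \<in> set xs \<Longrightarrow> \<exists>y. (x, y) \<in> set (cyclic_pairs xs)"
  by (metis cyclic_pairs_def length_rotate1 in_set_impl_in_set_zip1)

text \<open>The end \<open>y\<close> is independent of the start, since the induction moves the
  start and keeps the end; a closed walk is the case \<open>y = x\<close>.\<close>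

lemma cas_zip:
  fixes G :: "('v, 'v \<times> 'v) pre_digraph"
  assumes "tail G = fst" "head G = snd"
  shows "pre_digraph.cas G x (zip (x # xs) (xs @ [y])) y"
    and "pre_digraph.awalk_verts G x (zip (x # xs) (xs @ [y])) = x # xs @ [y]"
proof -
  interpret pre_digraph G .
  show "cas x (zip (x # xs) (xs @ [y])) y" "awalk_verts x (zip (x # xs) (xs @ [y])) = x # xs @ [y]"
    using assms by (induction xs arbitrary: x) auto
qed

lemma zero_divisor_graph_cyclicI:
  assumes nonzero: "set xs \<subseteq> cd_carrier n - {cd_zero n}"
    and mult: "\<forall>(x, y) \<in> set (cyclic_pairs xs). cd_mult g n x y = cd_zero n"
  shows "set (map cd_line xs) \<subseteq> verts (zero_divisor_graph g n)"
    and "(u, v) \<in> set (cyclic_pairs (map cd_line xs)) \<Longrightarrow> u \<noteq> v \<Longrightarrow> (u, v) \<in> arcs (zero_divisor_graph g n)"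
    and "distinct (map cd_line xs) \<Longrightarrow> 2 \<le> length xs \<Longrightarrow>
      pre_digraph.cycle (zero_divisor_graph g n) (cyclic_pairs (map cd_line xs))"
proof -
  let ?G = "zero_divisor_graph g n"
  have zd: "cd_zero_divisor g n x" if x: "x \<in> set xs" for x
  proof -
    obtain y where "(x, y) \<in> set (cyclic_pairs xs)" using in_cyclic_pairs[OF x] ..
    then show ?thesis
      using x nonzero mult set_cyclic_pairs_subset[of xs] unfolding cd_zero_divisor_def by blast
  qed
  then show verts: "set (map cd_line xs) \<subseteq> verts ?G"
    by (auto simp: zero_divisor_graph_def)
  show arcs: "(u, v) \<in> arcs ?G"
    if uv: "(u, v) \<in> set (cyclic_pairs (map cd_line xs))" "u \<noteq> v" for u v
  proof -
    obtain x y where xy: "(x, y) \<in> set (cyclic_pairs xs)" "u = cd_line x" "v = cd_line y"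
      using uv(1) by (auto simp: cyclic_pairs_map)
    then have "x \<in> set xs" "y \<in> set xs" "cd_mult g n x y = cd_zero n"
      using set_cyclic_pairs_subset mult by fast+
    with zd uv(2) xy(2,3) show ?thesis
      unfolding zero_divisor_graph_def pre_digraph.simps by blast
  qed
  assume dist: "distinct (map cd_line xs)" and len: "2 \<le> length xs"
  obtain u us where us: "map cd_line xs = u # us" "us \<noteq> []"
    using len by (cases xs) (auto simp: Suc_le_eq)
  interpret pre_digraph ?G .
  have G: "tail ?G = fst" "head ?G = snd" by (simp_all add: zero_divisor_graph_def)
  \<comment> \<open>The first index uses that \<open>us\<close> is nonempty, and the last one wraps
    around to \<open>u\<close>.\<close>
  have neq: "v \<noteq> w" if vw: "(v, w) \<in> set (cyclic_pairs (map cd_line xs))" for v w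
  proof -
    obtain i where i: "i < Suc (length us)" "v = (u # us) ! i" "w = (us @ [u]) ! i"
      using vw unfolding us cyclic_pairs_Cons in_set_zip by auto
    have "u \<notin> set us" "distinct us" using dist by (simp_all add: us)
    show ?thesis
    proof (cases i)
      case 0
      then have "v = u" "w \<in> set us" using i us(2) by (simp_all add: nth_append)
      with \<open>u \<notin> set us\<close> show ?thesis by blast
    next
      case (Suc j)
      show ?thesis
      proof (cases "Suc j < length us")
        case True
        with Suc i \<open>distinct us\<close> show ?thesis by (simp add: nth_append nth_eq_iff_index_eq)
      next
        case False
        with Suc i have "v \<in> set us" "w = u" by (simp_all add: nth_append)
        with \<open>u \<notin> set us\<close> show ?thesis by blast
      qed
    qed
  qed
  let ?p = "cyclic_pairs (map cd_line xs)"
  have p: "?p = zip (u # us) (us @ [u])" by (simp only: us cyclic_pairs_Cons)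
  have "set ?p \<subseteq> arcs ?G" using arcs neq by (auto simp only: subset_iff split_paired_All)
  moreover have "u \<in> verts ?G" using verts by (simp add: us)
  ultimately have "awalk u ?p u" unfolding awalk_def p using cas_zip(1)[OF G] by blast
  \<comment> \<open>The tail is \<open>us @ [u]\<close>, so the repeated endpoint counts
    once.\<close>
  moreover have "distinct (tl (awalk_verts u ?p))"
    using dist unfolding p cas_zip(2)[OF G] by (auto simp: us)
  moreover have "?p \<noteq> []" using us(2) by (cases us) (simp_all add: p)
  ultimately show "cycle ?p" unfolding cycle_def by blast
qed

text \<open>For \<open>\<chi> = 1\<close> lines can coincide: over the reals with
  \<open>g 0 = 1\<close>, the vertices \<open>(1, 1)\<close> and \<open>(1, -1)\<close> give a third
  vertex equal to the first. Hence arcs are claimed between distinct lines and the cycle under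
  distinctness, which is proved for \<open>\<chi> = - 1\<close>.\<close>

theorem corollary3p7:
  fixes g :: "nat \<Rightarrow> real" and n :: nat and a b c d :: cd and \<chi> :: real
  assumes "\<forall>k\<le>n. g k = 1 \<or> g k = - 1"
    and "a \<in> cd_carrier n" "b \<in> cd_carrier n" "c \<in> cd_carrier n" "d \<in> cd_carrier n"
    and "\<forall>x \<in> {a, b}. \<forall>y \<in> {c, d}. cd_alternates_strongly g n x y"
    and "cd_mult g (Suc n) (CPair a b) (CPair c d) = cd_zero (Suc n)"
    and "(cd_norm g n a)\<^sup>2 = (cd_norm g n b)\<^sup>2" "(cd_norm g n b)\<^sup>2 \<noteq> 0"
    and "(cd_norm g n c)\<^sup>2 = (cd_norm g n d)\<^sup>2" "(cd_norm g n d)\<^sup>2 \<noteq> 0"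
    and "\<chi> = g n * (cd_norm g n a / cd_norm g n b)"
    and "\<chi> = g n * (cd_norm g n b / cd_norm g n a)"
    and "\<chi> = g n * (cd_norm g n c / cd_norm g n d)"
    and "\<chi> = g n * (cd_norm g n d / cd_norm g n c)"
    and "\<chi> = 1 \<or> \<chi> = - 1"
  defines "G \<equiv> zero_divisor_graph g (Suc n)"
    and "vs \<equiv> [CPair a b,
               CPair c d,
               CPair (cd_conj (cd_mult g n a c)) (cd_scale (- \<chi>) (cd_mult g n d a)),
               CPair a (cd_neg b),
               CPair c (cd_neg d),
               CPair (cd_conj (cd_mult g n a c)) (cd_scale \<chi> (cd_mult g n d a))]"
  shows "set (map cd_line vs) \<subseteq> verts G \<and>
         (\<forall>(x, y) \<in> set (cyclic_pairs vs). cd_mult g (Suc n) x y = cd_zero (Suc n)) \<and>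
         (\<forall>(u, v) \<in> set (cyclic_pairs (map cd_line vs)). u \<noteq> v \<longrightarrow> (u, v) \<in> arcs G) \<and>
         (distinct (map cd_line vs) \<longrightarrow> pre_digraph.cycle G (cyclic_pairs (map cd_line vs))) \<and>
         (\<chi> = - 1 \<longrightarrow> distinct (map cd_line vs))"
  proof -
  note norms = assms(8-16)
  have norm_neq_0: "cd_norm g n a \<noteq> 0" "cd_norm g n b \<noteq> 0" "cd_norm g n c \<noteq> 0" "cd_norm g n d \<noteq> 0"
    using norms(1-4) by auto
  have gamma: "g n = 1 \<or> g n = - 1" using assms(1) by blast
  interpret cd_hexagon g n a b c d \<chi>
  proof
    \<comment> \<open>The quotient defining \<open>\<chi>\<close> is solved for the norm, using that
      \<open>g n\<close> squares to 1.\<close>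
    show "cd_norm g n a = \<chi> * g n * cd_norm g n b"
      using norms(5) norm_neq_0 gamma by auto
    show "cd_norm g n c = \<chi> * g n * cd_norm g n d"
      unfolding norms(7) using norm_neq_0 gamma by auto
  qed (use assms norm_neq_0 gamma in blast)+
  have vs: "vs = [P, Q, R, cd_flip P, cd_flip Q, cd_flip R]"
    by (simp add: vs_def cd_neg_def)
  note cycle = zero_divisor_graph_cyclicI[OF nonzero_vertices cyclic_products, folded vs G_def]
  have "2 \<le> length vs" by (simp add: vs_def)
  then show ?thesis
    using cycle cyclic_products[folded vs] distinct_lines[folded vs] by blast
qed

end
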